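(* Let $F\in\mathrm{et}(\mathbb{C}^2)$. The mappings $R_F,L_F:\mathrm{et}(\mathbb{C}^2)\to\mathrm{et}(\mathbb{C}^2)$ are not surjective if and only if $F\notin \mathrm{Aut}(\mathbb{C}^2)$. In fact, in this case (that is, when $F\notin\mathrm{Aut}(\mathbb{C}^2)$) we have $$R_F(\mathrm{et}(\mathbb{C}^2))\subset \mathrm{et}(\mathbb{C}^2)-\mathrm{Aut}(\mathbb{C}^2),\qquad L_F(\mathrm{et}(\mathbb{C}^2))\subset \mathrm{et}(\mathbb{C}^2)-\mathrm{Aut}(\mathbb{C}^2).$$
   Context: $\mathrm{et}(\mathbb{C}^2)$ denotes the set of all polynomial mappings $F=(P,Q)\in\mathbb{C}[X,Y]^2$, $F:\mathbb{C}^2\to\mathbb{C}^2$, such that (1) $\det J_F\equiv 1$ (Jacobian determinant), and (2) $\deg P=\deg_Y P$ and $\deg Q=\deg_Y Q$ (the total degree equals the degree in $Y$). The paper regards it as a semigroup under composition of mappings. $\mathrm{Aut}(\mathbb{C}^2)$ is the group of polynomial automorphisms of $\mathbb{C}^2$. For $F\in\mathrm{et}(\mathbb{C}^2)$ the right and left composition operators on $\mathrm{et}(\mathbb{C}^2)$ are $R_F(G)=G\circ F$ and $L_F(G)=F\circ G$.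
   Formalization: The set et(C²) given by (1) and (2) is not closed under composition: (2X+Y, X+Y) and (X−Y, −X+2Y) compose to the identity, which violates (2). Here et(C²) is replaced throughout by the semigroup it generates, that is, all polynomial maps with Jacobian determinant 1. *)

theory Defs
  imports Complex_Main "HOL-Library.FuncSet" "HOL-Computational_Algebra.Polynomial"
begin

text \<open>
  \<^typ>\<open>complex poly poly\<close> is used for the polynomial ring in two variables \<open>X\<close>, \<open>Y\<close> over the
  complex numbers: the outer variable is \<open>Y\<close> and the coefficients are polynomials in \<open>X\<close>, so
  \<open>coeff (coeff P i) j\<close> is the coefficient of the monomial \<open>X ^ j * Y ^ i\<close>, the degree in \<open>Y\<close>
  is \<open>degree P\<close>, and the partial derivatives with respect to \<open>X\<close> and \<open>Y\<close> are
  \<open>map_poly pderiv P\<close> and \<open>pderiv P\<close>.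
\<close>

definition eval2 :: "complex poly poly \<Rightarrow> complex \<times> complex \<Rightarrow> complex" where
  "eval2 P = (\<lambda>(x, y). poly (poly P [:y:]) x)"

definition total_degree :: "complex poly poly \<Rightarrow> nat" where
  "total_degree P = Max (insert 0 {i + j | i j. coeff (coeff P i) j \<noteq> 0})"

definition jacobian_det :: "complex poly poly \<Rightarrow> complex poly poly \<Rightarrow> complex poly poly" where
  "jacobian_det P Q = map_poly pderiv P * pderiv Q - pderiv P * map_poly pderiv Q"

definition polymap :: "complex poly poly \<Rightarrow> complex poly poly \<Rightarrow> complex \<times> complex \<Rightarrow> complex \<times> complex"
  where "polymap P Q z = (eval2 P z, eval2 Q z)"

definition et :: "(complex \<times> complex \<Rightarrow> complex \<times> complex) set" where
  "et = {polymap P Q | P Q. jacobian_det P Q = 1 \<and>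
           total_degree P = degree P \<and> total_degree Q = degree Q}"

definition Aut :: "(complex \<times> complex \<Rightarrow> complex \<times> complex) set" where
  "Aut = {F. F \<in> range (case_prod polymap) \<and> bij F \<and> inv F \<in> range (case_prod polymap)}"

text \<open>
  The degree condition is not stable under composition (lemma \<open>et_not_closed\<close> below): the set
  \<^const>\<open>et\<close> itself is not a semigroup, and right and left composition do not map it to itself.
  Moreover, for an automorphism \<open>F\<close> in \<^const>\<open>et\<close>, the only \<open>G\<close> with
  \<open>G \<circ> F = F\<close> or \<open>F \<circ> G = F\<close> is the identity, which is not in \<^const>\<open>et\<close>
  (lemma \<open>et_not_surj_literal\<close>). The semigroup under composition is therefore taken to be
  the one that \<^const>\<open>et\<close> generates.
\<close>

inductive_set et_semigroup :: "(complex \<times> complex \<Rightarrow> complex \<times> complex) set" where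
  et: "F \<in> et \<Longrightarrow> F \<in> et_semigroup"
| comp: "F \<in> et_semigroup \<Longrightarrow> G \<in> et_semigroup \<Longrightarrow> F \<circ> G \<in> et_semigroup"

definition R :: "(complex \<times> complex \<Rightarrow> complex \<times> complex) \<Rightarrow>
    (complex \<times> complex \<Rightarrow> complex \<times> complex) \<Rightarrow> complex \<times> complex \<Rightarrow> complex \<times> complex" where
  "R F G = G \<circ> F"

definition L :: "(complex \<times> complex \<Rightarrow> complex \<times> complex) \<Rightarrow>
    (complex \<times> complex \<Rightarrow> complex \<times> complex) \<Rightarrow> complex \<times> complex \<Rightarrow> complex \<times> complex" where
  "L F G = F \<circ> G"

lemma poly_const_lift: "poly (poly P [:y:]) x = poly (map_poly (\<lambda>p. poly p x) P) y"
  by (induction P) (simp_all add: map_poly_pCons)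

lemma eval2_inject:
  assumes "eval2 P = eval2 Q" shows "P = Q"
proof (rule poly_eqI)
  fix i
  have "poly (map_poly (\<lambda>p. poly p x) P) = poly (map_poly (\<lambda>p. poly p x) Q)" for x
    using fun_cong[OF assms, of "(x, _)"] by (simp add: eval2_def poly_const_lift fun_eq_iff)
  hence "map_poly (\<lambda>p. poly p x) P = map_poly (\<lambda>p. poly p x) Q" for x
    by (simp add: poly_eq_poly_eq_iff)
  hence "coeff (map_poly (\<lambda>p. poly p x) P) i = coeff (map_poly (\<lambda>p. poly p x) Q) i" for x
    by simp
  hence "poly (coeff P i) = poly (coeff Q i)"
    by (simp add: coeff_map_poly fun_eq_iff)
  thus "coeff P i = coeff Q i" by (simp add: poly_eq_poly_eq_iff)
qed

lemma coeff_linear: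
  "coeff (coeff [:[:0, a:], [:b:]:] i) j \<noteq> 0 \<longleftrightarrow> (i = 0 \<and> j = 1 \<and> a \<noteq> 0) \<or> (i = 1 \<and> j = 0 \<and> b \<noteq> 0)"
proof (cases i)
  case 0
  show ?thesis
    by (cases j) (simp_all add: 0 coeff_pCons split: nat.splits)
next
  case (Suc k)
  show ?thesis
    by (cases k; cases j) (simp_all add: Suc)
qed

lemma total_degree_linear:
  assumes "a \<noteq> 0 \<or> b \<noteq> 0" shows "total_degree [:[:0, a:], [:b:]:] = 1"
proof -
  have "{i + j | i j. coeff (coeff [:[:0, a:], [:b:]:] i) j \<noteq> 0} = {1}"
    unfolding coeff_linear using assms by force
  thus ?thesis by (simp add: total_degree_def)
qed

lemma id_notin_et: "id \<notin> et"
proof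
  assume "id \<in> et"
  then obtain P Q where PQ: "id = polymap P Q" "total_degree P = degree P"
    by (auto simp: et_def)
  have "eval2 P = eval2 [:[:0, 1:]:]"
  proof
    fix z :: "complex \<times> complex"
    show "eval2 P z = eval2 [:[:0, 1:]:] z"
      using fun_cong[OF PQ(1), of z] by (cases z) (auto simp: polymap_def eval2_def)
  qed
  hence "P = [:[:0, 1:]:]" by (rule eval2_inject)
  thus False using PQ(2) total_degree_linear[of 1 0] by simp
qed

lemma linear_in_et:
  assumes "a * d - b * c = 1" "b \<noteq> 0" "d \<noteq> 0"
  shows "(\<lambda>(x, y). (a * x + b * y, c * x + d * y)) \<in> et"
proof -
  have "(\<lambda>(x, y). (a * x + b * y, c * x + d * y)) = polymap [:[:0, a:], [:b:]:] [:[:0, c:], [:d:]:]"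
    by (auto simp: polymap_def eval2_def algebra_simps)
  moreover have "jacobian_det [:[:0, a:], [:b:]:] [:[:0, c:], [:d:]:] = 1"
    using assms by (simp add: jacobian_det_def map_poly_pCons pderiv_pCons one_pCons mult.commute)
  moreover have "total_degree [:[:0, a:], [:b:]:] = degree [:[:0, a:], [:b:]:]"
    "total_degree [:[:0, c:], [:d:]:] = degree [:[:0, c:], [:d:]:]"
    using assms by (subst total_degree_linear; simp)+
  ultimately show ?thesis
    unfolding et_def by blast
qed

lemma et_not_closed: "\<exists>F\<in>et. \<exists>G\<in>et. F \<circ> G \<notin> et"
proof (intro bexI)
  let ?F = "\<lambda>(x, y). (2 * x + y, x + y) :: complex \<times> complex"
  let ?G = "\<lambda>(x, y). (x - y, 2 * y - x) :: complex \<times> complex"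
  have "?F \<circ> ?G = id" by (auto simp: fun_eq_iff)
  thus "?F \<circ> ?G \<notin> et" using id_notin_et by simp
  show "?F \<in> et" using linear_in_et[of 2 1 1 1] by simp
  show "?G \<in> et" using linear_in_et[of 1 2 "-1" "-1"] by (simp add: algebra_simps)
qed

lemma et_not_surj_literal:
  assumes "F \<in> et" "F \<in> Aut"
  shows "\<not> et \<subseteq> R F ` et" "\<not> et \<subseteq> L F ` et"
proof -
  have bij: "bij F" using assms(2) by (simp add: Aut_def)
  show "\<not> et \<subseteq> R F ` et"
  proof
    assume "et \<subseteq> R F ` et"
    then obtain G where G: "G \<in> et" "F = G \<circ> F" using assms(1) unfolding R_def by blast
    have "G = id"
    proof
      fix z
      obtain w where w: "z = F w" using bij_is_surj[OF bij] by (rule surjE)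
      show "G z = id z" using fun_cong[OF G(2), of w, symmetric] w by simp
    qed
    thus False using G(1) id_notin_et by simp
  qed
  show "\<not> et \<subseteq> L F ` et"
  proof
    assume "et \<subseteq> L F ` et"
    then obtain G where G: "G \<in> et" "F = F \<circ> G" using assms(1) unfolding L_def by blast
    have "G = id"
    proof
      fix z
      have "F (G z) = F z" using fun_cong[OF G(2), of z, symmetric] by simp
      thus "G z = id z" using injD[OF bij_is_inj[OF bij]] by simp
    qed
    thus False using G(1) id_notin_et by simp
  qed
qed

end

theory Submission
  imports Defs
begin

text \<open>
  Precomposing with a generic shear \<open>(x + s y, y)\<close> makes the degree condition hold, and shears lie
  in \<^const>\<open>et\<close>; hence \<^const>\<open>et_semigroup\<close> consists of all polynomial maps with Jacobian
  determinant 1, and by the chain rule it contains the inverses of its automorphisms.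
  If \<open>F\<close> has Jacobian determinant 1, then \<open>E \<circ> F = 0\<close> for a polynomial \<open>E\<close> implies \<open>E = 0\<close>:
  both partial derivatives of \<open>E\<close> satisfy the same equation and have smaller degree.
  So a polynomial left inverse \<open>H\<close> of \<open>F\<close> is two-sided, because \<open>F \<circ> H - id\<close> vanishes on the
  image of \<open>F\<close>. Therefore both factors of a composite that is an automorphism are automorphisms.
\<close>

section \<open>Evaluation and substitution\<close>

lemma eval2_ring_hom [simp]:
  "eval2 0 z = 0" "eval2 1 z = 1"
  "eval2 (P + Q) z = eval2 P z + eval2 Q z"
  "eval2 (P - Q) z = eval2 P z - eval2 Q z"
  "eval2 (P * Q) z = eval2 P z * eval2 Q z"
  "eval2 (P ^ n) z = eval2 P z ^ n"
  "eval2 (smult p P) z = poly p (fst z) * eval2 P z"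
  "eval2 [:[:c:]:] z = c"
  by (simp_all add: eval2_def poly_power split: prod.split)

lemma eval2_sum: "eval2 (\<Sum>i\<in>I. f i) z = (\<Sum>i\<in>I. eval2 (f i) z)"
  by (simp add: eval2_def poly_sum split: prod.split)

lemma eval2_X_Y: "eval2 [:[:0, 1:]:] z = fst z" "eval2 [:0, 1:] z = snd z"
  by (simp_all add: eval2_def split: prod.split)

lemma eval2_pCons: "eval2 (pCons p P) z = poly p (fst z) + snd z * eval2 P z"
  by (simp add: eval2_def split: prod.split)

lemma eval2_altdef:
  "eval2 P (x, y) = (\<Sum>i\<le>degree P. \<Sum>j\<le>degree (coeff P i). coeff (coeff P i) j * x ^ j * y ^ i)"
proof -
  have "eval2 P (x, y) = (\<Sum>i\<le>degree P. poly (coeff P i) x * y ^ i)"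
    by (simp add: eval2_def poly_altdef[of P] poly_sum poly_power)
  thus ?thesis by (simp add: poly_altdef sum_distrib_right)
qed

text \<open>The polynomial ring is nested, so substitution takes two stages: \<open>subst1\<close>
  replaces X by \<open>A\<close> in a coefficient, and \<open>subst2\<close> then also replaces Y by
  \<open>B\<close>. Lifting scalars to constants lets \<open>poly\<close> evaluate in the bivariate
  ring.\<close>

definition subst1 :: "complex poly \<Rightarrow> complex poly poly \<Rightarrow> complex poly poly" where
  "subst1 p A = poly (map_poly (\<lambda>c. [:[:c:]:]) p) A"

definition subst2 :: "complex poly poly \<Rightarrow> complex poly poly \<Rightarrow> complex poly poly \<Rightarrow> complex poly poly"
  where "subst2 P A B = poly (map_poly (\<lambda>p. subst1 p A) P) B"

lemma subst1_0 [simp]: "subst1 0 A = 0"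
  by (simp add: subst1_def)

lemma subst1_pCons: "subst1 (pCons c p) A = [:[:c:]:] + A * subst1 p A"
  by (simp add: subst1_def map_poly_pCons)

lemma subst2_0 [simp]: "subst2 0 A B = 0"
  by (simp add: subst2_def)

lemma subst2_pCons: "subst2 (pCons p P) A B = subst1 p A + B * subst2 P A B"
  by (simp add: subst2_def map_poly_pCons)

lemma eval2_subst1: "eval2 (subst1 p A) z = poly p (eval2 A z)"
  by (induction p) (simp_all add: subst1_pCons)

lemma eval2_subst2: "eval2 (subst2 P A B) z = eval2 P (polymap A B z)"
  by (induction P) (simp_all add: subst2_pCons eval2_subst1 eval2_pCons polymap_def)

lemma polymap_comp: "polymap P Q \<circ> polymap A B = polymap (subst2 P A B) (subst2 Q A B)"
  by (rule ext) (simp add: polymap_def[of P] polymap_def[of "subst2 P A B"] eval2_subst2)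

lemma polymap_inject: "polymap P Q = polymap P' Q' \<longleftrightarrow> P = P' \<and> Q = Q'"
  by (auto simp: polymap_def fun_eq_iff intro!: eval2_inject)

lemma id_eq_polymap: "id = polymap [:[:0, 1:]:] [:0, 1:]"
  by (simp add: fun_eq_iff polymap_def eval2_X_Y)

text \<open>A polynomial is determined by its values, so it suffices to expand these into monomials.
  The sum allows total degrees to be bounded term by term.\<close>

lemma subst2_altdef:
  "subst2 P A B = (\<Sum>i\<le>degree P. \<Sum>j\<le>degree (coeff P i). [:[:coeff (coeff P i) j:]:] * (A ^ j * B ^ i))"
  by (rule eval2_inject, rule ext)
    (simp add: eval2_subst2 polymap_def eval2_altdef eval2_sum mult.assoc)

section \<open>The chain rule\<close>

text \<open>By the Leibniz rule, a derivation that kills constants is determined on polynomials in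
  \<open>A\<close> and \<open>B\<close> by \<open>D A\<close> and \<open>D B\<close>. One induction
  thus serves both partial derivatives.\<close>

lemma eval2_derivation_subst2:
  fixes D :: "complex poly poly \<Rightarrow> complex poly poly"
  assumes add: "\<And>P Q. D (P + Q) = D P + D Q"
    and mult: "\<And>P Q. D (P * Q) = P * D Q + D P * Q"
    and const: "\<And>c. D [:[:c:]:] = 0"
  shows "eval2 (D (subst2 P A B)) z = eval2 (map_poly pderiv P) (polymap A B z) * eval2 (D A) z
    + eval2 (pderiv P) (polymap A B z) * eval2 (D B) z"
proof -
  have zero: "D 0 = 0" using const[of 0] by simp
  have subst1: "eval2 (D (subst1 p A)) z = poly (pderiv p) (eval2 A z) * eval2 (D A) z" for p
    by (induction p)
      (simp_all add: zero subst1_pCons add mult const eval2_subst1 pderiv_pCons algebra_simps)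
  show ?thesis
    by (induction P)
      (simp_all add: zero subst2_pCons add mult subst1 map_poly_pCons pderiv_pCons eval2_pCons
        eval2_subst2 polymap_def algebra_simps)
qed

lemma map_poly_pderiv_add:
  "map_poly pderiv (P + Q) = map_poly pderiv P + map_poly pderiv (Q :: complex poly poly)"
  by (simp add: poly_eq_iff coeff_map_poly pderiv_add)

lemma map_poly_pderiv_mult:
  "map_poly pderiv (P * Q) = P * map_poly pderiv Q + map_poly pderiv P * (Q :: complex poly poly)"
proof (induction P)
  case (pCons p P)
  have "map_poly pderiv (smult p Q) = smult p (map_poly pderiv Q) + smult (pderiv p) Q"
    by (simp add: poly_eq_iff coeff_map_poly pderiv_mult mult.commute)
  with pCons show ?case
    by (simp add: map_poly_pderiv_add map_poly_pCons algebra_simps)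
qed simp

lemma eval2_dX_subst2:
  "eval2 (map_poly pderiv (subst2 P A B)) z
    = eval2 (map_poly pderiv P) (polymap A B z) * eval2 (map_poly pderiv A) z
    + eval2 (pderiv P) (polymap A B z) * eval2 (map_poly pderiv B) z"
  by (rule eval2_derivation_subst2)
    (simp_all add: map_poly_pderiv_add map_poly_pderiv_mult map_poly_pCons pderiv_pCons)

lemma eval2_dY_subst2:
  "eval2 (pderiv (subst2 P A B)) z = eval2 (map_poly pderiv P) (polymap A B z) * eval2 (pderiv A) z
    + eval2 (pderiv P) (polymap A B z) * eval2 (pderiv B) z"
  by (rule eval2_derivation_subst2) (simp_all add: pderiv_add pderiv_mult pderiv_pCons algebra_simps)

text \<open>By the two chain rules the Jacobian matrix of a composite is a product of matrices, and
  determinants multiply.\<close>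

lemma eval2_jacobian_det_subst2:
  "eval2 (jacobian_det (subst2 P A B) (subst2 Q A B)) z
    = eval2 (jacobian_det P Q) (polymap A B z) * eval2 (jacobian_det A B) z"
  by (simp add: jacobian_det_def eval2_dX_subst2 eval2_dY_subst2 algebra_simps)

section \<open>Total degree\<close>

text \<open>The degree in Y and the degrees of the coefficients bound all exponents, so the set
  under \<open>Max\<close> is finite and a bound can be tested monomial by monomial.\<close>

lemma total_degree_le_iff:
  "total_degree P \<le> n \<longleftrightarrow> (\<forall>i j. coeff (coeff P i) j \<noteq> 0 \<longrightarrow> i + j \<le> n)"
proof -
  let ?S = "{i + j | i j. coeff (coeff P i) j \<noteq> 0}"
  have "?S \<subseteq> (\<Union>i\<le>degree P. (\<lambda>j. i + j) ` {..degree (coeff P i)})"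
    by (force intro: le_degree simp: le_degree)
  hence "finite ?S" by (rule finite_subset) simp
  thus ?thesis by (subst total_degree_def, subst Max_le_iff) auto
qed

lemma degree_le_total_degree: "degree P \<le> total_degree P"
proof (cases "P = 0")
  case False
  then obtain j where "coeff (coeff P (degree P)) j \<noteq> 0"
    by (metis leading_coeff_0_iff poly_eqI coeff_0)
  thus ?thesis using total_degree_le_iff[of P "total_degree P"] by fastforce
qed simp

lemma degree_le_of_total_degree_le: "total_degree P \<le> n \<Longrightarrow> degree P \<le> n"
  using degree_le_total_degree[of P] by linarith

lemma total_degree_0 [simp]: "total_degree 0 = 0"
  using total_degree_le_iff[of 0 0] by simp

lemma total_degree_const [simp]: "total_degree [:[:c:]:] = 0"
  using total_degree_le_iff[of "[:[:c:]:]" 0] by (auto simp: coeff_pCons split: nat.splits)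

lemma total_degree_add_le:
  "total_degree P \<le> n \<Longrightarrow> total_degree Q \<le> n \<Longrightarrow> total_degree (P + Q) \<le> n"
  unfolding total_degree_le_iff by (metis add_0 coeff_add)

lemma total_degree_sum_le:
  "(\<And>i. i \<in> I \<Longrightarrow> total_degree (f i) \<le> n) \<Longrightarrow> total_degree (\<Sum>i\<in>I. f i) \<le> n"
  by (induction I rule: infinite_finite_induct) (auto intro: total_degree_add_le)

lemma total_degree_mult_le:
  assumes "total_degree P \<le> m" "total_degree Q \<le> n"
  shows "total_degree (P * Q) \<le> m + n"
  unfolding total_degree_le_iff
proof (intro allI impI)
  fix i j assume "coeff (coeff (P * Q) i) j \<noteq> 0"
  hence "(\<Sum>k\<le>i. \<Sum>l\<le>j. coeff (coeff P k) l * coeff (coeff Q (i - k)) (j - l)) \<noteq> 0"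
    by (simp add: coeff_mult coeff_sum)
  then obtain k where "k \<le> i" "(\<Sum>l\<le>j. coeff (coeff P k) l * coeff (coeff Q (i - k)) (j - l)) \<noteq> 0"
    by (meson atMost_iff sum.not_neutral_contains_not_neutral)
  moreover then obtain l where "l \<le> j" "coeff (coeff P k) l * coeff (coeff Q (i - k)) (j - l) \<noteq> 0"
    by (meson atMost_iff sum.not_neutral_contains_not_neutral)
  moreover from this have "k + l \<le> m" "(i - k) + (j - l) \<le> n"
    using assms unfolding total_degree_le_iff by (metis mult_zero_left, metis mult_zero_right)
  ultimately show "i + j \<le> m + n" by linarith
qed

lemma total_degree_power_le:
  "total_degree P \<le> m \<Longrightarrow> total_degree (P ^ k) \<le> k * m"
proof (induction k)
  case 0
  have "total_degree (1 :: complex poly poly) = 0"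
    using total_degree_const[of 1] by (simp add: one_pCons)
  thus ?case by simp
next
  case (Suc k)
  thus ?case using total_degree_mult_le[of P m "P ^ k" "k * m"] by simp
qed

section \<open>Top coefficients of products and powers\<close>

text \<open>Every other summand of the convolution has an index beyond \<open>m\<close> or
  \<open>n\<close>. These are only upper bounds for the degrees, so either factor on the right may
  be 0.\<close>

lemma coeff_mult_top:
  fixes P Q :: "'a::comm_semiring_1 poly"
  assumes "degree P \<le> m" "degree Q \<le> n"
  shows "coeff (P * Q) (m + n) = coeff P m * coeff Q n"
proof -
  have "coeff (P * Q) (m + n) = (\<Sum>k\<le>m + n. if k = m then coeff P m * coeff Q n else 0)"
    unfolding coeff_mult
  proof (rule sum.cong[OF refl])
    fix k
    show "coeff P k * coeff Q (m + n - k) = (if k = m then coeff P m * coeff Q n else 0)"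
      using assms by (cases k m rule: linorder_cases) (auto simp: coeff_eq_0)
  qed
  thus ?thesis by simp
qed

lemma coeff_power_top:
  fixes P :: "'a::comm_semiring_1 poly"
  assumes "degree P \<le> 1"
  shows "coeff (P ^ k) k = coeff P 1 ^ k"
proof (induction k)
  case (Suc k)
  have "degree (P ^ k) \<le> k"
    using degree_power_le[of P k] mult_right_mono[OF assms, of k] by linarith
  thus ?case using coeff_mult_top[OF assms, of "P ^ k" k] Suc by simp
qed simp

section \<open>Vanishing on the image of a map with Jacobian determinant 1\<close>

lemma total_degree_dX_le:
  assumes "total_degree P \<le> Suc n" shows "total_degree (map_poly pderiv P) \<le> n"
  unfolding total_degree_le_iff
proof (intro allI impI)
  fix i j assume "coeff (coeff (map_poly pderiv P) i) j \<noteq> 0"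
  hence "coeff (coeff P i) (Suc j) \<noteq> 0" by (auto simp: coeff_map_poly coeff_pderiv)
  thus "i + j \<le> n" using assms unfolding total_degree_le_iff by fastforce
qed

lemma total_degree_dY_le:
  assumes "total_degree P \<le> Suc n" shows "total_degree (pderiv P) \<le> n"
  unfolding total_degree_le_iff
proof (intro allI impI)
  fix i j assume "coeff (coeff (pderiv P) i) j \<noteq> 0"
  hence "coeff (coeff P (Suc i)) j \<noteq> 0"
    by (auto simp: coeff_pderiv of_nat_poly)
  thus "i + j \<le> n" using assms unfolding total_degree_le_iff by fastforce
qed

lemma derivatives_0_imp_const:
  fixes P :: "complex poly poly"
  assumes "map_poly pderiv P = 0" "pderiv P = 0"
  obtains c where "P = [:[:c:]:]"
proof -
  from assms(2) have "degree P = 0" by (simp add: pderiv_eq_0_iff)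
  then obtain p where p: "P = [:p:]" by (rule degree_eq_zeroE)
  hence "pderiv p = 0" using assms(1) by (simp add: map_poly_pCons)
  hence "degree p = 0" by (simp add: pderiv_eq_0_iff)
  then obtain c where "p = [:c:]" by (rule degree_eq_zeroE)
  with p that show thesis by blast
qed

text \<open>This is the algebraic independence of \<open>A\<close> and \<open>B\<close>.
  Differentiating the relation gives a homogeneous linear system for the partial derivatives of
  \<open>P\<close> at \<open>A\<close>, \<open>B\<close>, and its determinant is the
  Jacobian.\<close>

lemma eq_0_of_subst2_eq_0:
  assumes jac: "jacobian_det A B = 1" and "subst2 P A B = 0"
  shows "P = 0"
proof -
  \<comment> \<open>Induction on a bound instead of the degree itself covers both partial
    derivatives at once.\<close>
  have "P = 0" if "total_degree P \<le> n" "subst2 P A B = 0" for n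
    using that
  proof (induction n arbitrary: P)
    case 0
    obtain p where p: "P = [:p:]"
      using degree_le_of_total_degree_le[OF 0(1)] by (auto elim: degree_eq_zeroE)
    have "degree p = 0"
      using 0(1) p unfolding total_degree_le_iff
      by (metis add_0 coeff_pCons_0 degree_0 le_zero_eq leading_coeff_0_iff)
    then obtain c where "P = [:[:c:]:]" using p by (auto elim: degree_eq_zeroE)
    thus ?case using 0(2) by (simp add: subst2_pCons subst1_pCons)
  next
    case (Suc n)
    have "subst2 (map_poly pderiv P) A B = 0 \<and> subst2 (pderiv P) A B = 0"
    proof (intro conjI eval2_inject ext)
      fix z
      let ?a = "eval2 (map_poly pderiv P) (polymap A B z)" and ?b = "eval2 (pderiv P) (polymap A B z)"
      let ?Ax = "eval2 (map_poly pderiv A) z" and ?Ay = "eval2 (pderiv A) z"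
      let ?Bx = "eval2 (map_poly pderiv B) z" and ?By = "eval2 (pderiv B) z"
      have eqs: "?a * ?Ax + ?b * ?Bx = 0" "?a * ?Ay + ?b * ?By = 0"
        using eval2_dX_subst2[of P A B z] eval2_dY_subst2[of P A B z] Suc.prems(2) by simp_all
      have det: "?Ax * ?By - ?Ay * ?Bx = 1"
        using arg_cong[OF jac, of "\<lambda>J. eval2 J z"] by (simp add: jacobian_det_def)
      \<comment> \<open>Cramer's rule for a system of determinant 1.\<close>
      have "?a = (?a * ?Ax + ?b * ?Bx) * ?By - (?a * ?Ay + ?b * ?By) * ?Bx"
        "?b = (?a * ?Ay + ?b * ?By) * ?Ax - (?a * ?Ax + ?b * ?Bx) * ?Ay"
        using det by algebra+
      thus "eval2 (subst2 (map_poly pderiv P) A B) z = eval2 0 z"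
        "eval2 (subst2 (pderiv P) A B) z = eval2 0 z"
        unfolding eqs by (simp_all add: eval2_subst2)
    qed
    hence "map_poly pderiv P = 0" "pderiv P = 0"
      using Suc.IH total_degree_dX_le[OF Suc.prems(1)] total_degree_dY_le[OF Suc.prems(1)] by blast+
    then obtain c where "P = [:[:c:]:]" by (rule derivatives_0_imp_const)
    thus ?case using Suc.prems(2) by (simp add: subst2_pCons subst1_pCons)
  qed
  thus ?thesis using assms(2) by blast
qed

lemma polymap_left_inverse_imp_right_inverse:
  assumes jac: "jacobian_det A B = 1" and inv: "polymap P Q \<circ> polymap A B = id"
  shows "polymap A B \<circ> polymap P Q = id"
proof -
  have sub: "subst2 U A B = subst2 V A B \<Longrightarrow> U = V" for U V
  proof -
    assume "subst2 U A B = subst2 V A B"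
    hence "subst2 (U - V) A B = 0"
      by (intro eval2_inject ext) (metis eval2_ring_hom(1,4) eval2_subst2 diff_self)
    thus "U = V" using eq_0_of_subst2_eq_0[OF jac, of "U - V"] by simp
  qed
  \<comment> \<open>By \<open>sub\<close>, the common factor \<open>polymap A B\<close> can be
    cancelled on the right in each component.\<close>
  have "(polymap A B \<circ> polymap P Q) \<circ> polymap A B = id \<circ> polymap A B"
    using inv by (simp add: comp_assoc)
  thus ?thesis
    unfolding id_eq_polymap polymap_comp polymap_inject using sub by blast
qed

section \<open>The semigroup and its automorphisms\<close>

text \<open>Substituting polynomials of degree at most 1 cannot raise the total degree, and only
  monomials of degree exactly \<open>n\<close> can reach \<open>Y^n\<close>. Its coefficient is
  therefore the degree \<open>n\<close> form of \<open>P\<close> at the Y-coefficients of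
  \<open>A\<close> and \<open>B\<close>.\<close>

lemma
  assumes A: "total_degree A \<le> 1" and B: "total_degree B \<le> 1" and P: "total_degree P \<le> n"
  shows total_degree_subst2_le: "total_degree (subst2 P A B) \<le> n"
    and coeff_top_subst2: "coeff (coeff (subst2 P A B) n) 0 = (\<Sum>i\<le>n. coeff (coeff P i) (n - i)
      * coeff (coeff A 1) 0 ^ (n - i) * coeff (coeff B 1) 0 ^ i)"
proof -
  let ?c = "\<lambda>i j. coeff (coeff P i) j" and ?a = "coeff (coeff A 1) 0" and ?b = "coeff (coeff B 1) 0"
  let ?t = "\<lambda>i j. [:[:?c i j:]:] * (A ^ j * B ^ i)"
  have term_degree: "total_degree (?t i j) \<le> j + i" for i j
    using total_degree_mult_le[OF _ total_degree_mult_le[OF total_degree_power_le[OF A, of j]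
          total_degree_power_le[OF B, of i]], of "[:[:?c i j:]:]" 0] by simp
  have term_le: "total_degree (?t i j) \<le> n" for i j
  proof (cases "?c i j = 0")
    case False
    hence "i + j \<le> n" using P unfolding total_degree_le_iff by blast
    thus ?thesis using term_degree[of i j] by linarith
  qed simp
  show "total_degree (subst2 P A B) \<le> n"
    unfolding subst2_altdef by (intro total_degree_sum_le term_le)
  have term_top: "coeff (coeff (?t i j) n) 0 = (if j + i = n then ?c i j * ?a ^ j * ?b ^ i else 0)"
    for i j
  proof (cases "?c i j = 0")
    case c: False
    hence "i + j \<le> n" using P unfolding total_degree_le_iff by blast
    show ?thesis
    proof (cases "j + i = n")
      case True
      have "degree (A ^ j) \<le> j" "degree (B ^ i) \<le> i"
        using degree_le_of_total_degree_le[OF total_degree_power_le[OF A, of j]]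
          degree_le_of_total_degree_le[OF total_degree_power_le[OF B, of i]] by simp_all
      hence "coeff (A ^ j * B ^ i) n = coeff (A ^ j) j * coeff (B ^ i) i"
        using coeff_mult_top True by blast
      also have "\<dots> = coeff A 1 ^ j * coeff B 1 ^ i"
        using coeff_power_top degree_le_of_total_degree_le A B by metis
      finally show ?thesis using True by (simp add: coeff_0_power coeff_mult_0)
    next
      case False
      hence "\<not> n \<le> degree (?t i j)"
        using \<open>i + j \<le> n\<close> degree_le_of_total_degree_le[OF term_degree[of i j]] by linarith
      thus ?thesis using False by (simp only: coeff_eq_0 not_le coeff_0 if_False)
    qed
  qed simp
  \<comment> \<open>Subtraction truncates, so the case \<open>i > n\<close> is set to 0 explicitly.
    If \<open>n - i\<close> lies outside the range of summation, the coefficient there is 0.\<close>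
  have inner: "(\<Sum>j\<le>degree (coeff P i). coeff (coeff (?t i j) n) 0)
      = (if i \<le> n then ?c i (n - i) * ?a ^ (n - i) * ?b ^ i else 0)" for i
  proof -
    have "(\<Sum>j\<le>degree (coeff P i). coeff (coeff (?t i j) n) 0)
        = (\<Sum>j\<le>degree (coeff P i). if n - i = j then
            (if i \<le> n then ?c i (n - i) * ?a ^ (n - i) * ?b ^ i else 0) else 0)"
      unfolding term_top using P unfolding total_degree_le_iff
      by (intro sum.cong) auto
    thus ?thesis by (auto simp: coeff_eq_0)
  qed
  have "coeff (coeff (subst2 P A B) n) 0
      = (\<Sum>i\<le>degree P. if i \<le> n then ?c i (n - i) * ?a ^ (n - i) * ?b ^ i else 0)"
    unfolding subst2_altdef coeff_sum inner ..
  also have "\<dots> = (\<Sum>i\<le>n. ?c i (n - i) * ?a ^ (n - i) * ?b ^ i)"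
    using degree_le_of_total_degree_le[OF P] by (intro sum.mono_neutral_cong_left) (auto simp: coeff_eq_0)
  finally show "coeff (coeff (subst2 P A B) n) 0 = (\<Sum>i\<le>n. ?c i (n - i) * ?a ^ (n - i) * ?b ^ i)" .
qed

section \<open>Generic shears and the degree condition\<close>

abbreviation shear :: "complex \<Rightarrow> complex poly poly" where
  "shear s \<equiv> [:[:0, 1:], [:s:]:]"

text \<open>After the shear, the coefficient of \<open>Y^n\<close>, with \<open>n\<close> the total
  degree of \<open>P\<close>, is the top form of \<open>P\<close> at \<open>(s, 1)\<close>. For
  nonzero \<open>P\<close> this is a nonzero polynomial in \<open>s\<close>, and the exceptional
  shears are among its roots.\<close>

lemma finite_shears_total_degree_neq_degree:
  "finite {s. total_degree (subst2 P (shear s) [:0, 1:]) \<noteq> degree (subst2 P (shear s) [:0, 1:])}"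
proof (cases "P = 0")
  case False
  define n where "n = total_degree P"
  \<comment> \<open>The top form of \<open>P\<close>, dehomogenized by setting Y to 1.\<close>
  define f where "f = (\<Sum>i\<le>n. monom (coeff (coeff P i) (n - i)) (n - i))"
  have f: "poly f s = coeff (coeff (subst2 P (shear s) [:0, 1:]) n) 0" for s
  proof -
    have "total_degree (shear s) \<le> 1"
      using total_degree_linear[of 1 s] by simp
    moreover have "total_degree [:0, 1:] \<le> 1"
      using total_degree_linear[of 0 1] by (simp add: one_pCons)
    ultimately show ?thesis
      unfolding f_def n_def by (subst coeff_top_subst2) (simp_all add: poly_sum poly_monom)
  qed
  \<comment> \<open>For \<open>n = 0\<close> the maximum may come from the inserted 0, so a monomial
    is taken from \<open>P\<close> being nonzero.\<close>
  have "\<exists>i j. i + j = n \<and> coeff (coeff P i) j \<noteq> 0"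
  proof (cases n)
    case 0
    obtain i j where "coeff (coeff P i) j \<noteq> 0"
      using False by (metis leading_coeff_0_iff)
    moreover from this have "i + j \<le> n" using total_degree_le_iff n_def by blast
    ultimately show ?thesis using 0 by blast
  next
    case (Suc m)
    hence "\<not> total_degree P \<le> m" by (simp add: n_def)
    then obtain i j where "coeff (coeff P i) j \<noteq> 0" "\<not> i + j \<le> m"
      unfolding total_degree_le_iff by blast
    moreover from this have "i + j \<le> n" using total_degree_le_iff n_def by blast
    ultimately show ?thesis using Suc by (metis le_antisym not_less_eq_eq)
  qed
  then obtain i where i: "i \<le> n" "coeff (coeff P i) (n - i) \<noteq> 0"
    by (metis add_diff_cancel_left' le_add1)
  \<comment> \<open>The exponents \<open>n - k\<close> with \<open>k \<le> n\<close> are distinct,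
    so terms of \<open>f\<close> cannot cancel.\<close>
  have "coeff f (n - i) = (\<Sum>k\<le>n. if k = i then coeff (coeff P i) (n - i) else 0)"
    unfolding f_def coeff_sum using i(1) by (intro sum.cong) auto
  hence "f \<noteq> 0" using i by auto
  moreover have "total_degree (subst2 P (shear s) [:0, 1:]) = degree (subst2 P (shear s) [:0, 1:])"
    if "poly f s \<noteq> 0" for s
  proof -
    have "n \<le> degree (subst2 P (shear s) [:0, 1:])"
      using that unfolding f by (intro le_degree) auto
    moreover have "total_degree (subst2 P (shear s) [:0, 1:]) \<le> n"
      unfolding n_def using total_degree_linear[of 1 s] total_degree_linear[of 0 1]
      by (intro total_degree_subst2_le) (simp_all add: one_pCons)
    ultimately show ?thesis
      using degree_le_total_degree[of "subst2 P (shear s) [:0, 1:]"] by linarith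
  qed
  ultimately show ?thesis
    by (auto intro: finite_subset[OF _ poly_roots_finite[of f]])
qed simp

text \<open>The map is its composite with a shear followed on the right by the inverse shear. For
  all but finitely many \<open>s\<close> both factors lie in \<open>et\<close>.\<close>

lemma polymap_in_et_semigroup:
  assumes "jacobian_det P Q = 1"
  shows "polymap P Q \<in> et_semigroup"
proof -
  let ?bad = "\<lambda>P. {s. total_degree (subst2 P (shear s) [:0, 1:])
      \<noteq> degree (subst2 P (shear s) [:0, 1:])}"
  \<comment> \<open>The value 0 is excluded because the inverse shear would then be the identity,
    which is not in \<open>et\<close>.\<close>
  have "finite ({0} \<union> ?bad P \<union> ?bad Q)"
    by (intro finite_UnI finite_shears_total_degree_neq_degree) simp
  from ex_new_if_finite[OF infinite_UNIV_char_0 this]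
  obtain s where s: "s \<notin> {0} \<union> ?bad P \<union> ?bad Q" ..
  \<comment> \<open>The trivial coefficients are kept to match the form of
    \<open>linear_in_et\<close>.\<close>
  let ?S = "\<lambda>s. \<lambda>(x, y). (1 * x + s * y, 0 * x + 1 * y) :: complex \<times> complex"
  have S: "polymap (shear s) [:0, 1:] = ?S s"
    by (auto simp: fun_eq_iff polymap_def eval2_def)
  have "jacobian_det (shear s) [:0, 1:] = 1"
    by (simp add: jacobian_det_def map_poly_pCons pderiv_pCons one_pCons)
  hence "jacobian_det (subst2 P (shear s) [:0, 1:]) (subst2 Q (shear s) [:0, 1:]) = 1"
    by (intro eval2_inject ext) (simp add: eval2_jacobian_det_subst2 assms)
  hence F: "polymap P Q \<circ> polymap (shear s) [:0, 1:] \<in> et"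
    using s unfolding polymap_comp et_def by blast
  have S': "?S (- s) \<in> et"
    using s by (intro linear_in_et) auto
  have "polymap P Q = (polymap P Q \<circ> polymap (shear s) [:0, 1:]) \<circ> ?S (- s)"
    unfolding S by (simp add: fun_eq_iff)
  also have "\<dots> \<in> et_semigroup"
    by (intro et_semigroup.comp et_semigroup.et F S')
  finally show ?thesis .
qed

lemma et_semigroup_eq: "et_semigroup = {polymap P Q | P Q. jacobian_det P Q = 1}"
proof (intro subset_antisym subsetI)
  fix F assume "F \<in> et_semigroup"
  thus "F \<in> {polymap P Q | P Q. jacobian_det P Q = 1}"
  proof induction
    case (et F)
    thus ?case by (auto simp: et_def)
  next
    case (comp F G)
    then obtain P Q A B where *: "F = polymap P Q" "jacobian_det P Q = 1"
      "G = polymap A B" "jacobian_det A B = 1" by blast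
    hence "jacobian_det (subst2 P A B) (subst2 Q A B) = 1"
      by (intro eval2_inject ext) (simp add: eval2_jacobian_det_subst2)
    thus ?case using * polymap_comp by blast
  qed
qed (use polymap_in_et_semigroup in blast)

text \<open>Although absent from \<open>et\<close>, the identity lies in the generated semigroup. It
  is the element that the images under \<open>R F\<close> and \<open>L F\<close> miss when
  \<open>F\<close> is not an automorphism.\<close>

lemma id_in_et_semigroup: "id \<in> et_semigroup"
  unfolding id_eq_polymap
  by (rule polymap_in_et_semigroup)
    (simp add: jacobian_det_def map_poly_pCons pderiv_pCons one_pCons)

lemma id_in_Aut: "id \<in> Aut"
  using id_eq_polymap by (auto simp: Aut_def intro: range_eqI[of _ _ "(_, _)"])

section \<open>Inverses and factors of automorphisms\<close>

text \<open>In the chain rule for \<open>F \<circ> H = id\<close> the factor from \<open>F\<close>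
  is identically 1, which leaves determinant 1 for \<open>H\<close>.\<close>

lemma et_semigroup_right_inverse:
  assumes F: "F \<in> et_semigroup" and H: "H \<in> range (case_prod polymap)" and FH: "F \<circ> H = id"
  shows "H \<in> et_semigroup"
proof -
  obtain P Q where F: "F = polymap P Q" "jacobian_det P Q = 1"
    using F unfolding et_semigroup_eq by blast
  obtain A B where H: "H = polymap A B" using H by auto
  have "subst2 P A B = [:[:0, 1:]:]" "subst2 Q A B = [:0, 1:]"
    using FH unfolding F H id_eq_polymap polymap_comp polymap_inject by simp_all
  hence "jacobian_det (subst2 P A B) (subst2 Q A B) = 1"
    by (simp add: jacobian_det_def map_poly_pCons pderiv_pCons one_pCons)
  hence "jacobian_det A B = 1"
    using eval2_jacobian_det_subst2[of P A B Q] F(2) by (intro eval2_inject ext) simp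
  thus ?thesis unfolding H by (rule polymap_in_et_semigroup)
qed

lemma et_semigroup_left_inverse_imp_Aut:
  assumes F: "F \<in> et_semigroup" and H: "H \<in> range (case_prod polymap)" and HF: "H \<circ> F = id"
  shows "F \<in> Aut" "F \<circ> H = id"
proof -
  obtain A B where AB: "F = polymap A B" "jacobian_det A B = 1"
    using F unfolding et_semigroup_eq by blast
  show FH: "F \<circ> H = id"
    using H HF AB polymap_left_inverse_imp_right_inverse by auto
  have "bij F" using HF FH o_bij by blast
  moreover have "inv F = H" using HF FH inv_unique_comp by blast
  ultimately show "F \<in> Aut" using AB H by (auto simp: Aut_def)
qed

lemma inv_Aut:
  assumes "F \<in> Aut"
  shows "inv F \<in> range (case_prod polymap)" "inv F \<circ> F = id" "F \<circ> inv F = id"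
  using assms by (auto simp: Aut_def bij_is_inj bij_is_surj surj_iff[symmetric])

lemma range_polymap_comp:
  "F \<in> range (case_prod polymap) \<Longrightarrow> G \<in> range (case_prod polymap) \<Longrightarrow> F \<circ> G \<in> range (case_prod polymap)"
  using polymap_comp by fastforce

lemma et_semigroup_subset_range: "F \<in> et_semigroup \<Longrightarrow> F \<in> range (case_prod polymap)"
  unfolding et_semigroup_eq by auto

text \<open>With \<open>K\<close> the inverse of the composite, \<open>K \<circ> G\<close> is a left
  inverse of \<open>F\<close>, which suffices. For \<open>G\<close> associativity only gives the
  right inverse \<open>F \<circ> K\<close>, so the roles have to be exchanged.\<close>

lemma comp_in_Aut_imp_Aut:
  assumes F: "F \<in> et_semigroup" and G: "G \<in> et_semigroup" and GF: "G \<circ> F \<in> Aut"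
  shows "F \<in> Aut" "G \<in> Aut"
proof -
  define K where "K = inv (G \<circ> F)"
  note K = inv_Aut[OF GF, folded K_def]
  have "(K \<circ> G) \<circ> F = id" using K(2) by (simp add: comp_assoc)
  thus "F \<in> Aut"
    by (rule et_semigroup_left_inverse_imp_Aut(1)[OF F range_polymap_comp[OF K(1)
          et_semigroup_subset_range[OF G]]])
  \<comment> \<open>\<open>K\<close> is a right inverse of a member of the semigroup, hence itself a
    member.\<close>
  have FK: "F \<circ> K \<in> et_semigroup"
    using et_semigroup.comp[OF F et_semigroup_right_inverse[OF et_semigroup.comp[OF G F] K(1,3)]] .
  have "G \<circ> (F \<circ> K) = id" using K(3) by (simp add: comp_assoc)
  \<comment> \<open>Here \<open>G\<close> is read as a left inverse of \<open>F \<circ> K\<close>,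
    and left inverses in the semigroup are two-sided.\<close>
  hence "(F \<circ> K) \<circ> G = id"
    by (rule et_semigroup_left_inverse_imp_Aut(2)[OF FK et_semigroup_subset_range[OF G]])
  thus "G \<in> Aut"
    using et_semigroup_left_inverse_imp_Aut(1)[OF G et_semigroup_subset_range[OF FK]] by blast
qed

theorem proposition3p1:
  fixes F :: "complex \<times> complex \<Rightarrow> complex \<times> complex"
  assumes "F \<in> et_semigroup"
  shows "R F \<in> et_semigroup \<rightarrow> et_semigroup \<and> L F \<in> et_semigroup \<rightarrow> et_semigroup
    \<and> (R F ` et_semigroup \<noteq> et_semigroup \<longleftrightarrow> F \<notin> Aut)
    \<and> (L F ` et_semigroup \<noteq> et_semigroup \<longleftrightarrow> F \<notin> Aut)
    \<and> (F \<notin> Aut \<longrightarrow> R F ` et_semigroup \<subseteq> et_semigroup - Aut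
                  \<and> L F ` et_semigroup \<subseteq> et_semigroup - Aut)"
proof -
  have closed: "R F G \<in> et_semigroup" "L F G \<in> et_semigroup" if "G \<in> et_semigroup" for G
    using that assms by (auto simp: R_def L_def intro: et_semigroup.comp)
  have "R F G \<notin> Aut" "L F G \<notin> Aut" if "F \<notin> Aut" "G \<in> et_semigroup" for G
    using comp_in_Aut_imp_Aut(1)[OF assms that(2)] comp_in_Aut_imp_Aut(2)[OF that(2) assms] that(1)
    unfolding R_def L_def by blast+
  hence avoid: "R F ` et_semigroup \<subseteq> et_semigroup - Aut \<and> L F ` et_semigroup \<subseteq> et_semigroup - Aut"
    if "F \<notin> Aut"
    using that closed by blast
  \<comment> \<open>The preimages of \<open>G\<close> are \<open>G \<circ> inv F\<close> and
    \<open>inv F \<circ> G\<close>.\<close>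
  have "G \<in> R F ` et_semigroup \<and> G \<in> L F ` et_semigroup"
    if "F \<in> Aut" "G \<in> et_semigroup" for G
  proof -
    note inv = inv_Aut[OF that(1)]
    have "inv F \<in> et_semigroup" using et_semigroup_right_inverse[OF assms inv(1,3)] .
    hence "G \<circ> inv F \<in> et_semigroup" "inv F \<circ> G \<in> et_semigroup"
      using that(2) by (auto intro: et_semigroup.comp)
    moreover have "G = R F (G \<circ> inv F)" by (simp add: R_def comp_assoc inv(2))
    moreover have "G = L F (inv F \<circ> G)" by (simp add: L_def comp_assoc[symmetric] inv(3))
    ultimately show ?thesis by blast
  qed
  hence surj: "R F ` et_semigroup = et_semigroup" "L F ` et_semigroup = et_semigroup" if "F \<in> Aut"
    using closed that by blast+
  \<comment> \<open>Both images avoid \<open>Aut\<close>, whereas the semigroup meets it in the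
    identity.\<close>
  have "R F ` et_semigroup \<noteq> et_semigroup" "L F ` et_semigroup \<noteq> et_semigroup" if "F \<notin> Aut"
    using avoid[OF that] id_in_et_semigroup id_in_Aut by blast+
  with surj have "R F ` et_semigroup \<noteq> et_semigroup \<longleftrightarrow> F \<notin> Aut"
    "L F ` et_semigroup \<noteq> et_semigroup \<longleftrightarrow> F \<notin> Aut"
    by argo+
  with closed avoid show ?thesis
    by simp
qed

end
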